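(* For every real constant $\alpha>2$ there exists $k_0$ such that for every integer $k>k_0$ there exists a $k$-vertex-minor universal graph $G$ of order (number of vertices) at most $\alpha k^2$.
   Context: All graphs are finite, undirected and simple. A local complementation on a vertex $v$ of $G$ complements the subgraph induced by the neighborhood of $v$: the resulting graph has the same vertex set and edge set $E(G)\oplus E(K_{N_G(v)})$, where $K_S$ is the complete graph on $S$ and $\oplus$ is symmetric difference. A graph $G'$ with $V(G')\subseteq V(G)$ is a vertex-minor of $G$ if $G'$ is obtained exactly (not only up to isomorphism) from $G$ by a sequence of local complementations and deletions of the vertices of $V(G)\setminus V(G')$. For an integer $k>0$, $G$ is $k$-vertex-minor universal if $k\leqslant |V(G)|$ and, for every set $K$ of $k$ vertices of $G$, every graph with vertex set $K$ is a vertex-minor of $G$. *)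

theory Defs
  imports Complex_Main "HOL-Library.Ramsey"
begin

record 'a sgraph =
  vertices :: "'a set"
  edges :: "'a set set"

definition simple_graph :: "'a sgraph \<Rightarrow> bool" where
  "simple_graph G \<longleftrightarrow> finite (vertices G) \<and> edges G \<subseteq> [vertices G]\<^bsup>2\<^esup>"

definition neighborhood :: "'a sgraph \<Rightarrow> 'a \<Rightarrow> 'a set" where
  "neighborhood G v = {u. {u, v} \<in> edges G}"

definition local_complement :: "'a sgraph \<Rightarrow> 'a \<Rightarrow> 'a sgraph" where
  "local_complement G v =
     \<lparr>vertices = vertices G, edges = sym_diff (edges G) ([neighborhood G v]\<^bsup>2\<^esup>)\<rparr>"

definition delete_vertex :: "'a sgraph \<Rightarrow> 'a \<Rightarrow> 'a sgraph" where
  "delete_vertex G v =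
     \<lparr>vertices = vertices G - {v}, edges = {e \<in> edges G. v \<notin> e}\<rparr>"

inductive vertex_minor_step :: "'a sgraph \<Rightarrow> 'a sgraph \<Rightarrow> bool" where
  local_complement: "v \<in> vertices G \<Longrightarrow> vertex_minor_step G (local_complement G v)"
| delete_vertex: "v \<in> vertices G \<Longrightarrow> vertex_minor_step G (delete_vertex G v)"

text \<open>
  Steps never create vertices, so the vertices deleted on the way from \<open>G\<close> to \<open>H\<close>
  are exactly those in \<open>vertices G - vertices H\<close>.
\<close>

definition vertex_minor :: "'a sgraph \<Rightarrow> 'a sgraph \<Rightarrow> bool" where
  "vertex_minor H G \<longleftrightarrow> vertices H \<subseteq> vertices G \<and> vertex_minor_step\<^sup>*\<^sup>* G H"

definition vertex_minor_universal :: "nat \<Rightarrow> 'a sgraph \<Rightarrow> bool" where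
  "vertex_minor_universal k G \<longleftrightarrow>
     0 < k \<and> k \<le> card (vertices G) \<and>
     (\<forall>K. K \<subseteq> vertices G \<and> card K = k \<longrightarrow>
        (\<forall>H. simple_graph H \<and> vertices H = K \<longrightarrow> vertex_minor H G))"

end

theory Submission
  imports Defs "HOL-Library.FuncSet" "HOL-Real_Asymp.Real_Asymp"
begin

text \<open>
  Take a random bipartite graph with sides \<open>L\<close> and \<open>V - L\<close> of sizes \<open>j\<close> and \<open>3j\<close>, where
  \<open>j = \<lfloor>k\<^sup>2/2\<rfloor>\<close>. If \<open>K \<subseteq> L\<close>, local complementations at a set \<open>S \<subseteq> V - L\<close> followed by deletions
  leave on \<open>K\<close> the sum over \<open>GF(2)\<close> of the cliques on \<open>N(w) \<inter> K\<close>, \<open>w \<in> S\<close>. These cliques span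
  all graphs on \<open>K\<close> unless some nonempty edge set \<open>Q\<close> induces an even number of edges in every
  \<open>N(w)\<close>; as a nonzero quadratic polynomial over \<open>GF(2)\<close> vanishes at no more than \<open>3/4\<close> of
  all points, this has probability at most \<open>2\<^bsup>k(k-1)/2\<^esup> (3/4)\<^bsup>3j\<^esup> \<le> (27/32)\<^sup>j\<close>. A vertex \<open>u \<in> K - L\<close>
  is moved to the side \<open>L\<close> by pivoting on an edge \<open>uv\<close> with \<open>v \<in> L - K\<close>. Pivoting is injective,
  so the bad graphs for the new bipartition bound the bad graphs for the old one, and the only
  additional failure, \<open>N(u) \<subseteq> K\<close>, has probability at most \<open>2\<^bsup>k-j\<^esup>\<close>. The union bound over all \<open>K\<close>
  and all choices of pivots costs only a factor \<open>k\<^bsup>O(k)\<^esup>\<close>.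
\<close>

section \<open>Local complementation, deletion and vertex-minors\<close>

lemma doubleton_edge_local_complement:
  "{x, y} \<in> edges (local_complement G v) \<longleftrightarrow>
     ({x, y} \<in> edges G) \<noteq> (x \<noteq> y \<and> {x, v} \<in> edges G \<and> {y, v} \<in> edges G)"
  by (auto simp: local_complement_def neighborhood_def)

lemma vertices_local_complement [simp]: "vertices (local_complement G v) = vertices G"
  by (simp add: local_complement_def)

lemma simple_graph_edgeD:
  assumes "simple_graph G" "{x, y} \<in> edges G"
  shows "x \<in> vertices G" "y \<in> vertices G" "x \<noteq> y"
proof -
  have "{x, y} \<in> [vertices G]\<^bsup>2\<^esup>" using assms unfolding simple_graph_def by blast
  then show "x \<in> vertices G" "y \<in> vertices G" "x \<noteq> y" by (simp_all add: doubleton_in_nsets_2)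
qed

lemma simple_graph_eqI:
  assumes "simple_graph G" "simple_graph H" "vertices G = vertices H"
    and "\<And>x y. {x, y} \<in> edges G \<longleftrightarrow> {x, y} \<in> edges H"
  shows "(G :: 'a sgraph) = H"
proof -
  have doubleton: "\<exists>x y. e = {x, y}" if "simple_graph F" "e \<in> edges F" for F :: "'a sgraph" and e
  proof -
    have "e \<in> [vertices F]\<^bsup>2\<^esup>" using that unfolding simple_graph_def by blast
    then show ?thesis by (auto simp: nsets_def card_2_iff)
  qed
  have "edges G = edges H"
    using assms(4) doubleton[OF assms(1)] doubleton[OF assms(2)] by blast
  then show ?thesis using assms(3) by (intro sgraph.equality) simp_all
qed

lemma simple_graph_local_complement:
  assumes "simple_graph G"
  shows "simple_graph (local_complement G v)"
proof -
  have "neighborhood G v \<subseteq> vertices G"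
    using simple_graph_edgeD[OF assms] by (auto simp: neighborhood_def)
  then have "[neighborhood G v]\<^bsup>2\<^esup> \<subseteq> [vertices G]\<^bsup>2\<^esup>" by (rule nsets_mono)
  then show ?thesis using assms by (auto simp: simple_graph_def local_complement_def)
qed

text \<open>Since \<open>v\<close> carries no loop, complementing at \<open>v\<close> changes no
  edge at \<open>v\<close>. Its neighborhood survives, and the second complementation toggles the
  same pairs back.\<close>

lemma local_complement_involution:
  assumes "simple_graph G"
  shows "local_complement (local_complement G v) v = G"
proof (rule simple_graph_eqI)
  fix x y
  show "{x, y} \<in> edges (local_complement (local_complement G v) v) \<longleftrightarrow> {x, y} \<in> edges G"
    unfolding doubleton_edge_local_complement
    using simple_graph_edgeD(3)[OF assms, of v v] by auto
qed (simp_all add: assms simple_graph_local_complement)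

lemma vertex_minor_trans:
  "vertex_minor F G \<Longrightarrow> vertex_minor G H \<Longrightarrow> vertex_minor F H"
  by (auto simp: vertex_minor_def)

lemma vertex_minor_refl: "vertex_minor G G"
  by (simp add: vertex_minor_def)

lemma vertex_minor_local_complement:
  "v \<in> vertices G \<Longrightarrow> vertex_minor (local_complement G v) G"
  by (auto simp: vertex_minor_def intro: vertex_minor_step.intros)

lemma vertex_minor_delete_vertex:
  "v \<in> vertices G \<Longrightarrow> vertex_minor (delete_vertex G v) G"
  unfolding vertex_minor_def
  by (auto intro: vertex_minor_step.intros) (simp add: delete_vertex_def)

lemma vertex_minor_induced:
  assumes "finite D" "D \<subseteq> vertices G"
  shows "vertex_minor \<lparr>vertices = vertices G - D, edges = {e \<in> edges G. e \<inter> D = {}}\<rparr> G"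
  using assms
proof induction
  case empty
  then show ?case by (cases G) (simp add: vertex_minor_refl)
next
  case (insert d D)
  let ?G = "\<lparr>vertices = vertices G - D, edges = {e \<in> edges G. e \<inter> D = {}}\<rparr>"
  have "delete_vertex ?G d
      = \<lparr>vertices = vertices G - insert d D, edges = {e \<in> edges G. e \<inter> insert d D = {}}\<rparr>"
    by (auto simp: delete_vertex_def)
  moreover have "vertex_minor (delete_vertex ?G d) ?G"
    using insert by (intro vertex_minor_delete_vertex) auto
  then have "vertex_minor (delete_vertex ?G d) G"
    by (rule vertex_minor_trans) (use insert in simp)
  ultimately show ?case by simp
qed

section \<open>Bipartite graphs and pivoting\<close>

text \<open>Graphs are labelled and the bipartition is fixed, so the size of a subset divided by the
  size of the whole set plays the role of a probability.\<close>

definition bipartite_graphs :: "'a set \<Rightarrow> 'a set \<Rightarrow> 'a sgraph set" where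
  "bipartite_graphs V L = {G. simple_graph G \<and> vertices G = V \<and>
     (\<forall>x y. {x, y} \<in> edges G \<longrightarrow> (x \<in> L) \<noteq> (y \<in> L))}"

definition pivot :: "'a \<Rightarrow> 'a \<Rightarrow> 'a sgraph \<Rightarrow> 'a sgraph" where
  "pivot u v G = local_complement (local_complement (local_complement G u) v) u"

text \<open>The sequence \<open>u\<close>, \<open>v\<close>, \<open>u\<close> of involutions is a
  palindrome, so pivoting is its own inverse.\<close>

lemma inj_on_pivot: "inj_on (pivot u v) (bipartite_graphs V L)"
proof (rule inj_on_inverseI)
  fix G :: "'a sgraph" assume "G \<in> bipartite_graphs V L"
  then have "simple_graph G" by (simp add: bipartite_graphs_def)
  then show "pivot u v (pivot u v G) = G"
    by (simp add: pivot_def local_complement_involution simple_graph_local_complement)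
qed

text \<open>The three toggles are evaluated propositionally after loops have been excluded. In the
  last equivalence the right-hand correction is the GF(2) determinant of the adjacencies between
  \<open>x\<close>, \<open>y\<close> and \<open>u\<close>, \<open>v\<close>.\<close>

lemma edges_pivot:
  assumes "simple_graph G" "{u, v} \<in> edges G" "x \<noteq> u" "x \<noteq> v"
  shows "{x, u} \<in> edges (pivot u v G) \<longleftrightarrow> {x, v} \<in> edges G"
    and "{x, v} \<in> edges (pivot u v G) \<longleftrightarrow> {x, u} \<in> edges G"
    and "y \<noteq> u \<Longrightarrow> y \<noteq> v \<Longrightarrow> x \<noteq> y \<Longrightarrow> {x, y} \<in> edges (pivot u v G) \<longleftrightarrow>
      ({x, y} \<in> edges G) \<noteq>
        (({x, u} \<in> edges G \<and> {y, v} \<in> edges G) \<noteq> ({x, v} \<in> edges G \<and> {y, u} \<in> edges G))"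
proof -
  have n: "u \<noteq> v" "{u} \<notin> edges G" "{v} \<notin> edges G" "{v, u} \<in> edges G"
    using simple_graph_edgeD(3)[OF assms(1), of u u] simple_graph_edgeD(3)[OF assms(1), of v v]
      simple_graph_edgeD(3)[OF assms(1,2)] assms(2) by (auto simp: insert_commute)
  \<comment> \<open>Simplification collapses \<open>{u, u}\<close> to \<open>{u}\<close>, which the
    rule for doubletons no longer matches; the loops that arise on the way are therefore excluded
    beforehand.\<close>
  have "{u} \<notin> edges (local_complement (local_complement G u) v)"
    "{v} \<notin> edges (local_complement G u)"
    using doubleton_edge_local_complement[of u u] doubleton_edge_local_complement[of v v] n by simp_all
  note defs = this pivot_def doubleton_edge_local_complement
  show "{x, u} \<in> edges (pivot u v G) \<longleftrightarrow> {x, v} \<in> edges G"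
    using n assms(2-4) by (simp add: defs) argo
  show "{x, v} \<in> edges (pivot u v G) \<longleftrightarrow> {x, u} \<in> edges G"
    using n assms(2-4) by (simp add: defs) argo
  show "y \<noteq> u \<Longrightarrow> y \<noteq> v \<Longrightarrow> x \<noteq> y \<Longrightarrow> {x, y} \<in> edges (pivot u v G) \<longleftrightarrow>
      ({x, y} \<in> edges G) \<noteq>
        (({x, u} \<in> edges G \<and> {y, v} \<in> edges G) \<noteq> ({x, v} \<in> edges G \<and> {y, u} \<in> edges G))"
    using n assms(2-4) by (simp add: defs) argo
qed

text \<open>The vertices \<open>u\<close> and \<open>v\<close> exchange their other neighbors, hence
  their sides. Any other pair is toggled only if it joins a neighbor of \<open>u\<close> to a
  neighbor of \<open>v\<close>, and such vertices lie on opposite sides.\<close>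

lemma pivot_bipartite:
  assumes "G \<in> bipartite_graphs V L" "u \<notin> L" "v \<in> L" "{u, v} \<in> edges G"
  shows "pivot u v G \<in> bipartite_graphs V (insert u (L - {v}))"
proof -
  have G: "simple_graph G" "vertices G = V"
    and bip: "\<And>x y. {x, y} \<in> edges G \<Longrightarrow> (x \<in> L) \<noteq> (y \<in> L)"
    using assms(1) by (auto simp: bipartite_graphs_def)
  have simple: "simple_graph (pivot u v G)"
    using G by (simp add: pivot_def simple_graph_local_complement)
  note e = edges_pivot[OF G(1) assms(4)]
  have swap: "(x \<in> insert u (L - {v})) \<noteq> (y \<in> insert u (L - {v}))"
    if xy: "{x, y} \<in> edges (pivot u v G)" for x y
  proof -
    have "x \<noteq> y" using simple xy by (rule simple_graph_edgeD)
    consider "x = u" | "x = v" | "y = u" | "y = v" | "x \<notin> {u, v}" "y \<notin> {u, v}" by blast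
    then show ?thesis
    proof cases
      case 1
      then show ?thesis using xy \<open>x \<noteq> y\<close> assms(2,3) e(1)[of y] bip[of y v]
        by (cases "y = v") (auto simp: insert_commute)
    next
      case 2
      then show ?thesis using xy \<open>x \<noteq> y\<close> assms(2,3) e(2)[of y] bip[of y u]
        by (cases "y = u") (auto simp: insert_commute)
    next
      case 3
      then show ?thesis using xy \<open>x \<noteq> y\<close> assms(2,3) e(1)[of x] bip[of x v]
        by (cases "x = v") auto
    next
      case 4
      then show ?thesis using xy \<open>x \<noteq> y\<close> assms(2,3) e(2)[of x] bip[of x u]
        by (cases "x = u") auto
    next
      case 5
      then have "{x, y} \<in> edges G \<or> {x, u} \<in> edges G \<and> {y, v} \<in> edges G \<or>
          {x, v} \<in> edges G \<and> {y, u} \<in> edges G"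
        using xy \<open>x \<noteq> y\<close> e(3)[of x y] by auto
      then show ?thesis
        using 5 assms(2,3) bip[of x y] bip[of x u] bip[of y v] bip[of x v] bip[of y u] by auto
    qed
  qed
  show ?thesis
    using simple G swap by (auto simp: bipartite_graphs_def pivot_def)
qed

section \<open>Linear algebra over GF(2) with sets as vectors\<close>

lemma odd_card_sym_diff:
  assumes "finite A" "finite B"
  shows "odd (card (sym_diff A B)) \<longleftrightarrow> odd (card A) \<noteq> odd (card B)"
proof -
  have "card A = card (A - B) + card (A \<inter> B)"
    by (metis assms(1) card_Int_Diff add.commute)
  moreover have "card B = card (B - A) + card (A \<inter> B)"
    by (metis assms(2) card_Int_Diff add.commute Int_commute)
  moreover have "card (sym_diff A B) = card (A - B) + card (B - A)"
    using assms by (intro card_Un_disjoint) auto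
  ultimately show ?thesis by simp presburger
qed

text \<open>With symmetric difference as addition and the parity of an intersection as inner
  product, \<open>U\<close> is a proper subspace, and \<open>Q\<close> is a nonzero vector
  orthogonal to it. The induction removes one coordinate \<open>a\<close> and passes to the members
  of \<open>U\<close> that avoid \<open>a\<close>.\<close>

lemma sym_diff_closed_orthogonal:
  assumes "finite X" "U \<subseteq> Pow X" "{} \<in> U"
    and "\<And>A B. A \<in> U \<Longrightarrow> B \<in> U \<Longrightarrow> sym_diff A B \<in> U"
    and "U \<noteq> Pow X"
  shows "\<exists>Q\<subseteq>X. Q \<noteq> {} \<and> (\<forall>A\<in>U. even (card (Q \<inter> A)))"
  using assms
proof (induction X arbitrary: U)
  case empty
  then show ?case by auto
next
  case (insert a Y)
  note closed = insert.prems(3)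
  show ?case
  proof (cases "\<forall>A\<in>U. a \<notin> A")
    case True
    then show ?thesis by (intro exI[of _ "{a}"]) auto
  next
    case False
    then obtain B where B: "B \<in> U" "a \<in> B" by auto
    define U0 where "U0 = {A \<in> U. a \<notin> A}"
    have U0: "U0 \<subseteq> Pow Y" "{} \<in> U0" "\<And>A B. A \<in> U0 \<Longrightarrow> B \<in> U0 \<Longrightarrow> sym_diff A B \<in> U0"
      using insert.prems(1,2) closed by (auto simp: U0_def)
    have red: "sym_diff A B \<in> U0" if "A \<in> U" "a \<in> A" for A
      using that B closed by (auto simp: U0_def)
    \<comment> \<open>Otherwise adding \<open>B\<close>, which contains \<open>a\<close>, to the
      members of \<open>U0\<close> would produce every subset of \<open>insert a Y\<close>.\<close>
    have "U0 \<noteq> Pow Y"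
    proof
      assume eq: "U0 = Pow Y"
      have "A \<in> U" if A: "A \<subseteq> insert a Y" for A
      proof (cases "a \<in> A")
        case False
        then have "A \<in> U0" using eq A by auto
        then show ?thesis by (simp add: U0_def)
      next
        case True
        then have "sym_diff A B \<in> U0" using eq A B insert.prems(1) by auto
        then have "sym_diff (sym_diff A B) B \<in> U" using B closed by (auto simp: U0_def)
        moreover have "sym_diff (sym_diff A B) B = A" by auto
        ultimately show ?thesis by simp
      qed
      then show False using insert.prems by auto
    qed
    then obtain Q0 where Q0: "Q0 \<subseteq> Y" "Q0 \<noteq> {}" "\<And>A. A \<in> U0 \<Longrightarrow> even (card (Q0 \<inter> A))"
      using insert.IH[OF U0] by auto
    have finQ0: "finite Q0" using Q0(1) insert.hyps(1) by (rule finite_subset)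
    have aQ0: "a \<notin> Q0" using Q0(1) insert.hyps(2) by auto
    \<comment> \<open>Putting \<open>a\<close> into \<open>Q0\<close> flips the parity on
      \<open>B\<close> and leaves it unchanged on \<open>U0\<close>. As \<open>U0\<close> and
      \<open>B\<close> generate \<open>U\<close>, it suffices to be orthogonal to these.\<close>
    define Q where "Q = (if even (card (Q0 \<inter> B)) then Q0 else insert a Q0)"
    have finQ: "finite Q" using finQ0 by (simp add: Q_def)
    have QU0: "even (card (Q \<inter> A))" if "A \<in> U0" for A
    proof -
      have "Q \<inter> A = Q0 \<inter> A" using that by (auto simp: Q_def U0_def)
      then show ?thesis using Q0(3)[OF that] by simp
    qed
    have QB: "even (card (Q \<inter> B))"
      using aQ0 B finQ0 by (auto simp: Q_def Int_insert_left)
    have "even (card (Q \<inter> A))" if A: "A \<in> U" for A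
    proof (cases "a \<in> A")
      case True
      have "even (card (Q \<inter> sym_diff A B))" using red[OF A True] by (rule QU0)
      moreover have "Q \<inter> sym_diff A B = sym_diff (Q \<inter> A) (Q \<inter> B)" by auto
      ultimately show ?thesis
        using odd_card_sym_diff[of "Q \<inter> A" "Q \<inter> B"] finQ QB by simp
    qed (use A QU0 in \<open>auto simp: U0_def\<close>)
    moreover have "Q \<subseteq> insert a Y" "Q \<noteq> {}" using Q0 by (auto simp: Q_def)
    ultimately show ?thesis by blast
  qed
qed

text \<open>Duality: if the vectors \<open>{e \<in> X. P w e}\<close> for \<open>w \<in> R\<close>
  failed to span \<open>Pow X\<close>, a nonempty \<open>Q\<close> would be orthogonal to all of
  them, contrary to the last assumption. The set \<open>S\<close> holds the vectors that occur in a
  linear combination equal to \<open>F\<close>.\<close>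

lemma parity_span:
  assumes "finite X" "finite R" "F \<subseteq> X"
    and "\<And>Q. Q \<subseteq> X \<Longrightarrow> Q \<noteq> {} \<Longrightarrow> \<exists>w\<in>R. odd (card {e \<in> Q. P w e})"
  shows "\<exists>S\<subseteq>R. \<forall>e\<in>X. e \<in> F \<longleftrightarrow> odd (card {w \<in> S. P w e})"
proof -
  define f where "f S = {e \<in> X. odd (card {w \<in> S. P w e})}" for S
  let ?U = "f ` Pow R"
  have "?U = Pow X"
  proof (rule ccontr)
    assume ne: "?U \<noteq> Pow X"
    have sub: "?U \<subseteq> Pow X" by (auto simp: f_def)
    have empty: "{} \<in> ?U" by (intro image_eqI[of _ _ "{}"]) (auto simp: f_def)
    have closed: "sym_diff A B \<in> ?U" if AB: "A \<in> ?U" "B \<in> ?U" for A B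
    proof -
      obtain S T where ST: "S \<subseteq> R" "A = f S" "T \<subseteq> R" "B = f T" using AB by auto
      have fin: "finite S" "finite T" using ST assms(2) finite_subset by auto
      have "odd (card {w \<in> sym_diff S T. P w e})
          \<longleftrightarrow> odd (card {w \<in> S. P w e}) \<noteq> odd (card {w \<in> T. P w e})" for e
      proof -
        have "{w \<in> sym_diff S T. P w e} = sym_diff {w \<in> S. P w e} {w \<in> T. P w e}" by auto
        show ?thesis
          unfolding \<open>{w \<in> sym_diff S T. P w e} = _\<close> using fin by (intro odd_card_sym_diff) auto
      qed
      then have "f (sym_diff S T) = sym_diff A B"
        unfolding ST f_def by auto
      then show ?thesis using ST by (intro image_eqI[of _ _ "sym_diff S T"]) auto
    qed
    obtain Q where Q: "Q \<subseteq> X" "Q \<noteq> {}" "\<And>A. A \<in> ?U \<Longrightarrow> even (card (Q \<inter> A))"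
      using sym_diff_closed_orthogonal[OF assms(1) sub empty closed ne] by blast
    obtain w where w: "w \<in> R" "odd (card {e \<in> Q. P w e})" using assms(4)[OF Q(1,2)] by blast
    \<comment> \<open>A singleton \<open>{w}\<close> gives back the generator belonging to
      \<open>w\<close>, on which \<open>Q\<close> is odd.\<close>
    have "{v \<in> {w}. P v e} = (if P w e then {w} else {})" for e by auto
    then have "f {w} = {e \<in> X. P w e}" by (auto simp: f_def)
    then have "Q \<inter> f {w} = {e \<in> Q. P w e}" using Q(1) by auto
    then show False using Q(3)[of "f {w}"] w by auto
  qed
  then have "F \<in> ?U" using assms(3) by simp
  then obtain S where "S \<subseteq> R" "f S = F" by auto
  then show ?thesis by (intro exI[of _ S]) (auto simp: f_def)
qed

section \<open>Realizing graphs on a subset of one side\<close>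

text \<open>Vertices of \<open>S\<close> are pairwise nonadjacent and have all neighbors in
  \<open>L\<close>, so each complementation toggles only pairs inside \<open>L\<close>. The
  invariant on edges with an end outside \<open>L\<close> keeps the later neighborhoods equal to
  those in \<open>G\<close>, and the cliques simply add up modulo 2.\<close>

lemma local_complement_independent_set:
  assumes G: "G \<in> bipartite_graphs V L" and "finite S" "S \<subseteq> V - L"
  shows "\<exists>G'. vertex_minor G' G \<and> vertices G' = V \<and> simple_graph G' \<and>
    (\<forall>w y. w \<notin> L \<longrightarrow> ({y, w} \<in> edges G' \<longleftrightarrow> {y, w} \<in> edges G)) \<and>
    (\<forall>x\<in>L. \<forall>y\<in>L. x \<noteq> y \<longrightarrow>
       ({x, y} \<in> edges G' \<longleftrightarrow> odd (card {w \<in> S. {x, y} \<subseteq> neighborhood G w})))"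
  using assms(2,3)
proof induction
  case empty
  show ?case using G by (intro exI[of _ G]) (auto simp: bipartite_graphs_def vertex_minor_refl)
next
  case (insert s S)
  then obtain G' where G': "vertex_minor G' G" "vertices G' = V" "simple_graph G'"
    "\<And>w y. w \<notin> L \<Longrightarrow> {y, w} \<in> edges G' \<longleftrightarrow> {y, w} \<in> edges G"
    "\<And>x y. x \<in> L \<Longrightarrow> y \<in> L \<Longrightarrow> x \<noteq> y \<Longrightarrow>
       ({x, y} \<in> edges G' \<longleftrightarrow> odd (card {w \<in> S. {x, y} \<subseteq> neighborhood G w}))"
    by auto
  have s: "s \<in> V" "s \<notin> L" using insert.prems by auto
  have bip: "\<And>x y. {x, y} \<in> edges G \<Longrightarrow> (x \<in> L) \<noteq> (y \<in> L)"
    using G by (auto simp: bipartite_graphs_def)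
  have split: "{w. (w = s \<or> w \<in> S) \<and> Q w} = (if Q s then insert s {w \<in> S. Q w} else {w \<in> S. Q w})" for Q
    by auto
  let ?H = "local_complement G' s"
  have "vertex_minor ?H G"
    using G'(1,2) s by (auto intro: vertex_minor_trans vertex_minor_local_complement)
  moreover have "{y, w} \<in> edges ?H \<longleftrightarrow> {y, w} \<in> edges G" if "w \<notin> L" for w y
  proof -
    have "{w, s} \<notin> edges G" using that s bip by blast
    then show ?thesis using that s by (simp add: doubleton_edge_local_complement G')
  qed
  moreover have "{x, y} \<in> edges ?H \<longleftrightarrow> odd (card {w \<in> insert s S. {x, y} \<subseteq> neighborhood G w})"
    if "x \<in> L" "y \<in> L" "x \<noteq> y" for x y
    using that s insert.hyps
    by (simp add: doubleton_edge_local_complement G' split neighborhood_def)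
  ultimately show ?case
    using G' by (intro exI[of _ ?H]) (simp add: simple_graph_local_complement)
qed

text \<open>By \<open>parity_span\<close>, the edge set of \<open>H\<close> is a GF(2) sum of
  cliques on sets \<open>neighborhood G w \<inter> K\<close>. Complementing at the chosen
  \<open>w\<close> creates this sum on \<open>K\<close>, and deleting the remaining vertices
  isolates it.\<close>

lemma vertex_minor_of_parity:
  assumes G: "G \<in> bipartite_graphs V L" and "K \<subseteq> L" "L \<subseteq> V"
    and H: "simple_graph H" "vertices H = K"
    and odd: "\<And>Q. Q \<subseteq> [K]\<^bsup>2\<^esup> \<Longrightarrow> Q \<noteq> {} \<Longrightarrow>
      \<exists>w\<in>V - L. odd (card {e \<in> Q. e \<subseteq> neighborhood G w})"
  shows "vertex_minor H G"
proof -
  have finV: "finite V" using G by (auto simp: bipartite_graphs_def simple_graph_def)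
  have finK: "finite K" using assms(2,3) finV by (meson finite_subset)
  have "\<exists>S\<subseteq>V - L. \<forall>e\<in>[K]\<^bsup>2\<^esup>. e \<in> edges H \<longleftrightarrow> odd (card {w \<in> S. e \<subseteq> neighborhood G w})"
    using H finV finK odd by (intro parity_span) (auto simp: simple_graph_def finite_imp_finite_nsets)
  then obtain S where S: "S \<subseteq> V - L"
    "\<And>e. e \<in> [K]\<^bsup>2\<^esup> \<Longrightarrow> e \<in> edges H \<longleftrightarrow> odd (card {w \<in> S. e \<subseteq> neighborhood G w})"
    by auto
  have "finite S" using S(1) finV by (meson finite_Diff finite_subset)
  from local_complement_independent_set[OF G this S(1)]
  obtain G' where G': "vertex_minor G' G" "vertices G' = V" "simple_graph G'"
    "\<And>x y. x \<in> L \<Longrightarrow> y \<in> L \<Longrightarrow> x \<noteq> y \<Longrightarrow>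
       ({x, y} \<in> edges G' \<longleftrightarrow> odd (card {w \<in> S. {x, y} \<subseteq> neighborhood G w}))"
    by auto
  \<comment> \<open>The vertex set stays in the form \<open>V - (V - K)\<close> to match
    \<open>vertex_minor_induced\<close>.\<close>
  let ?H = "\<lparr>vertices = V - (V - K), edges = {e \<in> edges G'. e \<inter> (V - K) = {}}\<rparr>"
  have "vertex_minor ?H G'"
    using vertex_minor_induced[of "V - K" G'] finV G'(2) by auto
  then have "vertex_minor ?H G" using G'(1) by (rule vertex_minor_trans)
  moreover have "?H = H"
  proof (rule simple_graph_eqI)
    have sub: "edges G' \<subseteq> [V]\<^bsup>2\<^esup>" using G' by (simp add: simple_graph_def)
    have "V - (V - K) = K" using assms(2,3) by auto
    moreover have "{e \<in> edges G'. e \<inter> (V - K) = {}} \<subseteq> [K]\<^bsup>2\<^esup>"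
      using sub by (auto simp: nsets_def)
    ultimately show "simple_graph ?H" using finK by (simp add: simple_graph_def)
    show "vertices ?H = vertices H" using assms(2,3) H by auto
    fix x y
    have K: "x \<in> V \<and> y \<in> V \<and> x \<noteq> y" if "{x, y} \<in> edges G'"
      using simple_graph_edgeD[OF G'(3) that] G'(2) by auto
    have K': "x \<in> K \<and> y \<in> K \<and> x \<noteq> y" if "{x, y} \<in> edges H"
      using simple_graph_edgeD[OF H(1) that] H(2) by auto
    show "{x, y} \<in> edges ?H \<longleftrightarrow> {x, y} \<in> edges H"
    proof (cases "x \<in> K \<and> y \<in> K \<and> x \<noteq> y")
      case True
      then have "x \<in> L" "y \<in> L" using assms(2) by auto
      then show ?thesis using True G'(4)[of x y] S(2)[of "{x, y}"] by auto
    next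
      case False
      then show ?thesis using K K' by auto
    qed
  qed (rule H(1))
  ultimately show ?thesis by simp
qed

section \<open>Counting bipartite graphs through neighborhoods\<close>

text \<open>Fix an edge \<open>{a, b}\<close> of \<open>Q\<close> and group the subsets of
  \<open>L\<close> by their part outside \<open>{a, b}\<close>. The four counts in a group have odd
  sum, because \<open>{a, b}\<close> is the only edge of \<open>Q\<close> with both ends in
  \<open>{a, b}\<close>. Hence at least one in four counts is odd.\<close>

lemma card_even_induced_le:
  assumes "finite L" "Q \<subseteq> [L]\<^bsup>2\<^esup>" "Q \<noteq> {}"
  shows "real (card {X \<in> Pow L. even (card {e \<in> Q. e \<subseteq> X})}) \<le> 3 / 4 * 2 ^ card L"
proof -
  define c where "c X = card {e \<in> Q. e \<subseteq> X}" for X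
  have finQ: "finite Q" using assms finite_imp_finite_nsets finite_subset by blast
  obtain e where "e \<in> Q" using assms(3) by auto
  moreover from this have "e \<in> [L]\<^bsup>2\<^esup>" using assms(2) by blast
  ultimately obtain a b where ab: "{a, b} \<in> Q" "a \<in> L" "b \<in> L" "a \<noteq> b"
    by (auto simp: nsets_def card_2_iff)
  let ?M = "L - {a, b}" and ?even = "{X \<in> Pow L. even (c X)}" and ?odd = "{X \<in> Pow L. odd (c X)}"
  have pair: "e = {a, b}" if "e \<in> Q" "a \<in> e" "b \<in> e" for e
  proof -
    have "e \<in> [L]\<^bsup>2\<^esup>" using that(1) assms(2) by blast
    then show ?thesis using that(2,3) ab(4) by (auto simp: nsets_def card_2_iff)
  qed
  have "\<exists>X\<in>?odd. X - {a, b} = Z" if Z: "Z \<subseteq> ?M" for Z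
  proof (rule ccontr)
    assume none: "\<not> ?thesis"
    have even_c: "even (c X)" if "X \<subseteq> L" "X - {a, b} = Z" for X
      using none that by auto
    \<comment> \<open>Apart from \<open>{a, b}\<close> itself, an edge induced by
      \<open>insert a (insert b Z)\<close> misses \<open>b\<close> or misses \<open>a\<close>.
      Inclusion-exclusion on \<open>?A\<close> and \<open>?B\<close> then relates the four
      counts.\<close>
    let ?A = "{e \<in> Q. e \<subseteq> insert a Z}" and ?B = "{e \<in> Q. e \<subseteq> insert b Z}"
    have "{e \<in> Q. e \<subseteq> insert a (insert b Z)} = insert {a, b} (?A \<union> ?B)"
      using pair ab(1) by blast
    moreover have "{a, b} \<notin> ?A \<union> ?B" using Z ab(4) by auto
    ultimately have "c (insert a (insert b Z)) = Suc (card (?A \<union> ?B))"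
      using finQ by (simp add: c_def)
    moreover have "insert a Z \<inter> insert b Z = Z" using Z ab(4) by auto
    then have "?A \<inter> ?B = {e \<in> Q. e \<subseteq> Z}" by blast
    then have "c (insert a Z) + c (insert b Z) = card (?A \<union> ?B) + c Z"
      using card_Un_Int[of ?A ?B] finQ by (simp add: c_def)
    moreover have "even (c Z)" "even (c (insert a Z))" "even (c (insert b Z))"
        "even (c (insert a (insert b Z)))"
      using Z ab by (auto intro!: even_c)
    ultimately show False by presburger
  qed
  then have "Pow ?M \<subseteq> (\<lambda>X. X - {a, b}) ` ?odd" by blast
  then have "card (Pow ?M) \<le> card ?odd"
    using assms(1) by (intro surj_card_le[of ?odd]) auto
  moreover have "card (Pow ?M) = 2 ^ (card L - 2)"
    using assms(1) ab by (simp add: card_Pow card_Diff_subset)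
  moreover have "?even \<union> ?odd = Pow L" by auto
  then have "card ?even + card ?odd = card (Pow L)"
    using assms(1) by (subst card_Un_disjoint[symmetric]) auto
  moreover have "card (Pow L) = 4 * 2 ^ (card L - 2)"
  proof -
    \<comment> \<open>Having two elements in \<open>L\<close> ensures that the subtraction in
      \<open>card L - 2\<close> is not truncated.\<close>
    have "card {a, b} \<le> card L" using assms(1) ab by (intro card_mono) auto
    then have "card L = Suc (Suc (card L - 2))" using ab(4) by simp
    then have "(2::nat) ^ card L = 2 ^ Suc (Suc (card L - 2))" by presburger
    then show ?thesis using assms(1) by (simp add: card_Pow)
  qed
  ultimately have "4 * card ?even \<le> 3 * card (Pow L)" by linarith
  then have "real (4 * card ?even) \<le> real (3 * card (Pow L))" by (rule of_nat_mono)
  then show ?thesis using assms(1) by (simp add: c_def card_Pow)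
qed

text \<open>The neighborhoods of the vertices in \<open>V - L\<close> are arbitrary subsets of
  \<open>L\<close> and determine the graph. Using \<open>restrict\<close> makes the codomain an
  extensional function space, whose size is a product.\<close>

lemma bij_betw_bipartite_graphs:
  assumes "finite V" "L \<subseteq> V"
  shows "bij_betw (\<lambda>G. restrict (neighborhood G) (V - L)) (bipartite_graphs V L) (V - L \<rightarrow>\<^sub>E Pow L)"
proof (rule bij_betw_imageI)
  show "inj_on (\<lambda>G. restrict (neighborhood G) (V - L)) (bipartite_graphs V L)"
  proof (rule inj_onI)
    fix G H
    assume G: "G \<in> bipartite_graphs V L" and H: "H \<in> bipartite_graphs V L"
      and eq: "restrict (neighborhood G) (V - L) = restrict (neighborhood H) (V - L)"
    have nb: "neighborhood G w = neighborhood H w" if "w \<in> V - L" for w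
      using fun_cong[OF eq, of w] that by simp
    \<comment> \<open>Stated for arbitrary \<open>F\<close> and \<open>F'\<close> so that it yields
      both inclusions between the edge sets.\<close>
    have imp: "{x, y} \<in> edges F'"
      if xy: "{x, y} \<in> edges F" and F: "F \<in> bipartite_graphs V L"
        and nb: "\<And>w. w \<in> V - L \<Longrightarrow> neighborhood F w = neighborhood F' w" for x y F F'
    proof -
      have xyV: "x \<in> V" "y \<in> V" "(x \<in> L) \<noteq> (y \<in> L)"
        using F xy simple_graph_edgeD[of F x y] by (auto simp: bipartite_graphs_def)
      show ?thesis
      proof (cases "x \<in> L")
        case True
        then show ?thesis using xyV xy nb[of y] by (auto simp: neighborhood_def)
      next
        case False
        then have "y \<in> neighborhood F x" using xy by (simp add: neighborhood_def insert_commute)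
        then have "y \<in> neighborhood F' x" using False xyV nb[of x] by simp
        then show ?thesis by (simp add: neighborhood_def insert_commute)
      qed
    qed
    show "G = H"
    proof (rule simple_graph_eqI)
      show "{x, y} \<in> edges G \<longleftrightarrow> {x, y} \<in> edges H" for x y
        using imp[OF _ G, of x y H] imp[OF _ H, of x y G] nb by auto
    qed (use G H in \<open>simp_all add: bipartite_graphs_def\<close>)
  qed
  show "(\<lambda>G. restrict (neighborhood G) (V - L)) ` bipartite_graphs V L = (V - L \<rightarrow>\<^sub>E Pow L)"
  proof (intro equalityI subsetI)
    fix f assume "f \<in> (\<lambda>G. restrict (neighborhood G) (V - L)) ` bipartite_graphs V L"
    then show "f \<in> V - L \<rightarrow>\<^sub>E Pow L"
      by (auto simp: bipartite_graphs_def neighborhood_def)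
  next
    fix f assume f: "f \<in> V - L \<rightarrow>\<^sub>E Pow L"
    have fL: "x \<in> L" if "w \<in> V" "w \<notin> L" "x \<in> f w" for x w
      using PiE_mem[OF f, of w] that by auto
    define G where "G = \<lparr>vertices = V, edges = {{x, w} | x w. w \<in> V - L \<and> x \<in> f w}\<rparr>"
    have "edges G \<subseteq> [V]\<^bsup>2\<^esup>"
    proof
      fix e assume "e \<in> edges G"
      then obtain x w where e: "e = {x, w}" "w \<in> V - L" "x \<in> f w" by (auto simp: G_def)
      then have "x \<in> L" using fL by blast
      then show "e \<in> [V]\<^bsup>2\<^esup>" using e assms(2) by auto
    qed
    moreover have "(x \<in> L) \<noteq> (y \<in> L)" if "{x, y} \<in> edges G" for x y
      using that fL by (auto simp: G_def doubleton_eq_iff)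
    ultimately have "G \<in> bipartite_graphs V L"
      using assms(1) by (auto simp: bipartite_graphs_def simple_graph_def G_def)
    moreover have "neighborhood G w = f w" if "w \<in> V - L" for w
      using that fL by (auto simp: G_def neighborhood_def doubleton_eq_iff)
    then have "restrict (neighborhood G) (V - L) = f"
      using f by (auto simp: restrict_def PiE_def extensional_def fun_eq_iff)
    ultimately show "f \<in> (\<lambda>G. restrict (neighborhood G) (V - L)) ` bipartite_graphs V L"
      by (intro image_eqI[of _ _ G]) simp_all
  qed
qed

lemma finite_bipartite_graphs:
  "finite V \<Longrightarrow> L \<subseteq> V \<Longrightarrow> finite (bipartite_graphs V L)"
  using bij_betw_finite[OF bij_betw_bipartite_graphs, of V L] finite_PiE[of "V - L" "\<lambda>_. Pow L"]
    finite_subset[of L V] by simp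

lemma card_bipartite_graphs:
  assumes "finite V" "L \<subseteq> V"
  shows "card (bipartite_graphs V L) = 2 ^ (card L * card (V - L))"
  using bij_betw_same_card[OF bij_betw_bipartite_graphs[OF assms]] assms finite_subset[OF assms(2,1)]
  by (simp add: card_PiE card_Pow power_mult)

text \<open>This expresses the independence of the neighborhoods. It serves both for a parity
  condition at every \<open>w\<close> and for a condition at a single vertex.\<close>

lemma card_bipartite_graphs_neighborhood_le:
  assumes "finite V" "L \<subseteq> V" "\<And>w. w \<in> V - L \<Longrightarrow> T w \<subseteq> Pow L"
  shows "card {G \<in> bipartite_graphs V L. \<forall>w\<in>V - L. neighborhood G w \<in> T w}
    \<le> (\<Prod>w\<in>V - L. card (T w))"
proof -
  let ?C = "{G \<in> bipartite_graphs V L. \<forall>w\<in>V - L. neighborhood G w \<in> T w}"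
  have fin: "finite (V - L)" "finite (Pow L)" using assms(1,2) finite_subset by auto
  have "finite (Pi\<^sub>E (V - L) T)"
    using fin assms(3) by (intro finite_PiE) (auto intro: finite_subset)
  moreover have "inj_on (\<lambda>G. restrict (neighborhood G) (V - L)) ?C"
    using bij_betw_bipartite_graphs[OF assms(1,2)]
    by (auto simp: bij_betw_def intro: inj_on_subset)
  moreover have "(\<lambda>G. restrict (neighborhood G) (V - L)) ` ?C \<subseteq> Pi\<^sub>E (V - L) T" by auto
  ultimately have "card ?C \<le> card (Pi\<^sub>E (V - L) T)" by (intro card_inj_on_le)
  then show ?thesis using fin by (simp add: card_PiE)
qed

section \<open>Counting the graphs that fail for a given vertex set\<close>

text \<open>The bad event for one set \<open>K\<close>, which may meet both sides: the bipartition
  can then change by pivoting while \<open>K\<close> stays fixed.\<close>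

definition nonuniversal_graphs :: "'a set \<Rightarrow> 'a set \<Rightarrow> 'a set \<Rightarrow> 'a sgraph set" where
  "nonuniversal_graphs V K L = {G \<in> bipartite_graphs V L.
     \<exists>H. simple_graph H \<and> vertices H = K \<and> \<not> vertex_minor H G}"

text \<open>A bad graph has an obstruction \<open>Q\<close> to
  \<open>vertex_minor_of_parity\<close>, so a union bound over all \<open>Q\<close> applies. For
  fixed \<open>Q\<close>, each of the independent neighborhoods is even with probability at most
  3/4. The first factor is the number of all graphs.\<close>

lemma card_nonuniversal_base:
  assumes "finite V" "L \<subseteq> V" "K \<subseteq> L"
  shows "real (card (nonuniversal_graphs V K L))
    \<le> 2 ^ (card L * card (V - L)) * (2 ^ (card K choose 2) * (3 / 4) ^ card (V - L))"
proof -
  let ?l = "card L" and ?m = "card (V - L)"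
  have finL: "finite L" and finK: "finite K" using assms finite_subset by metis+
  let ?C = "\<lambda>Q. {G \<in> bipartite_graphs V L.
    \<forall>w\<in>V - L. neighborhood G w \<in> {X \<in> Pow L. even (card {e \<in> Q. e \<subseteq> X})}}"
  let ?I = "Pow ([K]\<^bsup>2\<^esup>) - {{}}"
  have finI: "finite ?I" using finK by (simp add: finite_imp_finite_nsets)
  have "nonuniversal_graphs V K L \<subseteq> (\<Union>Q\<in>?I. ?C Q)"
  proof
    fix G assume "G \<in> nonuniversal_graphs V K L"
    then obtain H where H: "G \<in> bipartite_graphs V L" "simple_graph H" "vertices H = K" "\<not> vertex_minor H G"
      by (auto simp: nonuniversal_graphs_def)
    then have "\<exists>Q. Q \<subseteq> [K]\<^bsup>2\<^esup> \<and> Q \<noteq> {} \<and> (\<forall>w\<in>V - L. even (card {e \<in> Q. e \<subseteq> neighborhood G w}))"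
      using vertex_minor_of_parity[OF H(1) assms(3,2) H(2,3)] by blast
    then obtain Q where Q: "Q \<subseteq> [K]\<^bsup>2\<^esup>" "Q \<noteq> {}"
        "\<forall>w\<in>V - L. even (card {e \<in> Q. e \<subseteq> neighborhood G w})" by blast
    have "neighborhood G w \<subseteq> L" if "w \<in> V - L" for w
      using H(1) that by (auto simp: bipartite_graphs_def neighborhood_def)
    then have "G \<in> ?C Q" using Q(3) H(1) by simp
    then show "G \<in> (\<Union>Q\<in>?I. ?C Q)" using Q(1,2) by blast
  qed
  then have "card (nonuniversal_graphs V K L) \<le> card (\<Union>Q\<in>?I. ?C Q)"
    using finI finite_bipartite_graphs[OF assms(1,2)] by (intro card_mono) auto
  also have "\<dots> \<le> (\<Sum>Q\<in>?I. card (?C Q))" by (rule card_UN_le[OF finI])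
  finally have "real (card (nonuniversal_graphs V K L)) \<le> real (\<Sum>Q\<in>?I. card (?C Q))"
    by (rule of_nat_mono)
  also have "\<dots> = (\<Sum>Q\<in>?I. real (card (?C Q)))" by (rule of_nat_sum)
  also have "\<dots> \<le> (\<Sum>Q\<in>?I. (3 / 4 * 2 ^ ?l) ^ ?m)"
  proof (rule sum_mono)
    fix Q assume "Q \<in> ?I"
    then have Q: "Q \<subseteq> [L]\<^bsup>2\<^esup>" "Q \<noteq> {}" using nsets_mono[OF assms(3), of 2] by auto
    have "card (?C Q) \<le> (\<Prod>w\<in>V - L. card {X \<in> Pow L. even (card {e \<in> Q. e \<subseteq> X})})"
      using assms(1,2) by (intro card_bipartite_graphs_neighborhood_le) auto
    then have "card (?C Q) \<le> card {X \<in> Pow L. even (card {e \<in> Q. e \<subseteq> X})} ^ ?m"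
      by (simp only: prod_constant)
    then have "real (card (?C Q)) \<le> real (card {X \<in> Pow L. even (card {e \<in> Q. e \<subseteq> X})}) ^ ?m"
      unfolding of_nat_power[symmetric] by (rule of_nat_mono)
    also have "\<dots> \<le> (3 / 4 * 2 ^ ?l) ^ ?m"
      using card_even_induced_le[OF finL Q] by (intro power_mono) auto
    finally show "real (card (?C Q)) \<le> (3 / 4 * 2 ^ ?l) ^ ?m" .
  qed
  also have "\<dots> = card ?I * (3 / 4 * 2 ^ ?l) ^ ?m" by simp
  also have "\<dots> \<le> 2 ^ (card K choose 2) * (3 / 4 * 2 ^ ?l) ^ ?m"
  proof (rule mult_right_mono)
    have "card ?I \<le> card (Pow ([K]\<^bsup>2\<^esup>))"
      using finK by (intro card_mono) (auto simp: finite_imp_finite_nsets)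
    then show "real (card ?I) \<le> 2 ^ (card K choose 2)"
      using of_nat_mono[of "card ?I" "2 ^ (card K choose 2)"] finK
      by (simp add: card_Pow finite_imp_finite_nsets)
  qed simp
  also have "(3 / 4 * 2 ^ ?l) ^ ?m = (2 ^ (?l * ?m) * (3 / 4) ^ ?m :: real)"
    by (simp only: power_mult_distrib power_mult) (rule mult.commute)
  finally show ?thesis by (simp only: mult.left_commute)
qed

lemma card_small_neighborhood_le:
  assumes "finite V" "L \<subseteq> V" "finite K" "u \<in> V - L"
  shows "real (card {G \<in> bipartite_graphs V L. neighborhood G u \<subseteq> K})
    \<le> 2 ^ (card L * card (V - L)) * (2 ^ card K / 2 ^ card L)"
proof -
  let ?T = "\<lambda>w. if w = u then Pow (L \<inter> K) else Pow L"
  have finL: "finite L" using assms finite_subset by metis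
  have "{G \<in> bipartite_graphs V L. neighborhood G u \<subseteq> K}
      \<subseteq> {G \<in> bipartite_graphs V L. \<forall>w\<in>V - L. neighborhood G w \<in> ?T w}"
    using assms(4) by (auto simp: bipartite_graphs_def neighborhood_def split: if_splits)
  then have "card {G \<in> bipartite_graphs V L. neighborhood G u \<subseteq> K}
      \<le> card {G \<in> bipartite_graphs V L. \<forall>w\<in>V - L. neighborhood G w \<in> ?T w}"
    using finite_bipartite_graphs[OF assms(1,2)] by (intro card_mono) auto
  also have "\<dots> \<le> (\<Prod>w\<in>V - L. card (?T w))"
    using assms(1,2) by (intro card_bipartite_graphs_neighborhood_le) auto
  also have "\<dots> = 2 ^ card (L \<inter> K) * (\<Prod>w\<in>V - L - {u}. card (?T w))"
    using assms(1,4) finL by (subst prod.remove[of _ u]) (auto simp: card_Pow simp del: Pow_Int_eq)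
  also have "(\<Prod>w\<in>V - L - {u}. card (?T w)) = (\<Prod>w\<in>V - L - {u}. 2 ^ card L)"
    using finL by (intro prod.cong) (auto simp: card_Pow)
  also have "\<dots> = (2 ^ card L) ^ (card (V - L) - 1)"
    using assms(1,4) by (simp add: card_Diff_singleton)
  also have "2 ^ card (L \<inter> K) * (2 ^ card L) ^ (card (V - L) - 1)
      \<le> (2::nat) ^ card K * (2 ^ card L) ^ (card (V - L) - 1)"
    using assms(3) by (intro mult_right_mono power_increasing card_mono) auto
  finally have *: "real (card {G \<in> bipartite_graphs V L. neighborhood G u \<subseteq> K})
      \<le> real (2 ^ card K * (2 ^ card L) ^ (card (V - L) - 1))" by (rule of_nat_mono)
  \<comment> \<open>The vertex \<open>u\<close> makes this positive, so the exponent
    \<open>card (V - L) - 1\<close> is a true predecessor.\<close>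
  have "card (V - L) > 0" using assms(1,4) by (auto simp: card_gt_0_iff)
  then have "(2::real) ^ (card L * card (V - L)) = 2 ^ card L * (2 ^ card L) ^ (card (V - L) - 1)"
    by (metis power_mult power_minus_mult mult.commute)
  then show ?thesis using * by (simp add: mult.commute)
qed

lemma vertex_minor_pivot:
  assumes "u \<in> vertices G" "v \<in> vertices G"
  shows "vertex_minor (pivot u v G) G"
  unfolding pivot_def
  by (intro vertex_minor_trans[OF vertex_minor_local_complement]
      vertex_minor_trans[OF vertex_minor_local_complement vertex_minor_local_complement])
    (simp_all add: assms)

text \<open>Induction on the number of vertices of \<open>K\<close> on the wrong side. For such a
  vertex \<open>u\<close>, either \<open>neighborhood G u \<subseteq> K\<close>, or one of at most
  \<open>l\<close> neighbors \<open>v\<close> outside \<open>K\<close> allows a pivot that lowers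
  this number. The two alternatives contribute the summands 1 and \<open>l\<close> of the factor
  \<open>1 + l\<close>.\<close>

lemma card_nonuniversal_le:
  assumes "finite V" "K \<subseteq> V" "L \<subseteq> V" "card L = l" "card V = l + m" "card (K - L) = i"
  shows "real (card (nonuniversal_graphs V K L)) \<le>
    real (1 + l) ^ i * (2 ^ (l * m) * (2 ^ (card K choose 2) * (3 / 4) ^ m + 2 ^ card K / 2 ^ l))"
  using assms(3,4,6)
proof (induction i arbitrary: L)
  case 0
  have finK: "finite K" using assms finite_subset by metis
  have m: "card (V - L) = m" using 0 assms(1,5) by (simp add: card_Diff_subset finite_subset)
  have "K \<subseteq> L" using 0 finK by auto
  from card_nonuniversal_base[OF assms(1) "0.prems"(1) this]
  have "real (card (nonuniversal_graphs V K L))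
      \<le> 2 ^ (l * m) * (2 ^ (card K choose 2) * (3 / 4) ^ m)" using 0 m by simp
  also have "\<dots> \<le> 2 ^ (l * m) * (2 ^ (card K choose 2) * (3 / 4) ^ m + 2 ^ card K / 2 ^ l)"
    by (intro mult_left_mono) auto
  finally show ?case by simp
next
  case (Suc i)
  \<comment> \<open>A common bound for the base case and for the exceptional graphs with
    \<open>neighborhood G u \<subseteq> K\<close>.\<close>
  let ?\<beta> = "2 ^ (l * m) * (2 ^ (card K choose 2) * (3 / 4) ^ m + 2 ^ card K / 2 ^ l) :: real"
  have finK: "finite K" and finL: "finite L" using assms Suc.prems finite_subset by metis+
  have m: "card (V - L) = m" using Suc.prems assms(1,5) finL by (simp add: card_Diff_subset)
  have "K - L \<noteq> {}" using Suc.prems(3) by force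
  then obtain u where u: "u \<in> K" "u \<notin> L" by auto
  then have uV: "u \<in> V" using assms by auto
  let ?A = "{G \<in> bipartite_graphs V L. neighborhood G u \<subseteq> K}"
  let ?B = "\<lambda>v. {G \<in> nonuniversal_graphs V K L. {u, v} \<in> edges G}"
  have finB: "finite (nonuniversal_graphs V K L)" if "L \<subseteq> V" for L
    using finite_bipartite_graphs[OF assms(1) that] by (simp add: nonuniversal_graphs_def)
  have "nonuniversal_graphs V K L \<subseteq> ?A \<union> (\<Union>v\<in>L - K. ?B v)"
  proof
    fix G assume G: "G \<in> nonuniversal_graphs V K L"
    then have bip: "G \<in> bipartite_graphs V L" by (simp add: nonuniversal_graphs_def)
    show "G \<in> ?A \<union> (\<Union>v\<in>L - K. ?B v)"
    proof (cases "neighborhood G u \<subseteq> K")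
      case False
      then obtain v where v: "{v, u} \<in> edges G" "v \<notin> K" by (auto simp: neighborhood_def)
      then have "v \<in> L" using bip u by (auto simp: bipartite_graphs_def)
      then show ?thesis using G v by (auto simp: insert_commute)
    qed (use bip in simp)
  qed
  then have "card (nonuniversal_graphs V K L) \<le> card (?A \<union> (\<Union>v\<in>L - K. ?B v))"
    using finite_bipartite_graphs[OF assms(1) Suc.prems(1)] finL finB[OF Suc.prems(1)]
    by (intro card_mono) auto
  also have "\<dots> \<le> card ?A + card (\<Union>v\<in>L - K. ?B v)" by (rule card_Un_le)
  also have "card (\<Union>v\<in>L - K. ?B v) \<le> (\<Sum>v\<in>L - K. card (?B v))"
    using finL by (intro card_UN_le) simp
  finally have "real (card (nonuniversal_graphs V K L)) \<le> real (card ?A + (\<Sum>v\<in>L - K. card (?B v)))"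
    by (intro of_nat_mono) simp
  also have "\<dots> = real (card ?A) + (\<Sum>v\<in>L - K. real (card (?B v)))" by simp
  also have "\<dots> \<le> ?\<beta> + (\<Sum>v\<in>L - K. real (1 + l) ^ i * ?\<beta>)"
  proof (intro add_mono sum_mono)
    have "real (card ?A) \<le> 2 ^ (l * m) * (2 ^ card K / 2 ^ l)"
      using card_small_neighborhood_le[OF assms(1) Suc.prems(1) finK, of u] u uV m Suc.prems(2) by simp
    also have "\<dots> \<le> ?\<beta>" by (intro mult_left_mono) auto
    finally show "real (card ?A) \<le> ?\<beta>" .
  next
    fix v assume v: "v \<in> L - K"
    let ?L = "insert u (L - {v})"
    have L': "?L \<subseteq> V" "card ?L = l"
      using v u uV Suc.prems(1,2) finL card_Suc_Diff1[of L v] by auto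
    have "K - ?L = K - L - {u}" using v u by auto
    then have i: "card (K - ?L) = i" using Suc.prems(3) u finK by simp
    \<comment> \<open>Bad graphs stay bad: a vertex-minor of the pivoted graph is also one of
      \<open>G\<close>. Injectivity of the pivot then turns this inclusion into a bound on
      \<open>?B v\<close>.\<close>
    have "pivot u v ` ?B v \<subseteq> nonuniversal_graphs V K ?L"
    proof
      fix G' assume "G' \<in> pivot u v ` ?B v"
      then obtain G H where G: "G' = pivot u v G" "G \<in> bipartite_graphs V L" "{u, v} \<in> edges G"
        and H: "simple_graph H" "vertices H = K" "\<not> vertex_minor H G"
        by (auto simp: nonuniversal_graphs_def)
      have "vertex_minor G' G"
        unfolding G(1) using G(2) uV v Suc.prems(1)
        by (intro vertex_minor_pivot) (auto simp: bipartite_graphs_def)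
      then have "\<not> vertex_minor H G'" using H(3) vertex_minor_trans by metis
      moreover have "G' \<in> bipartite_graphs V ?L"
        unfolding G(1) using G u v by (intro pivot_bipartite) auto
      ultimately show "G' \<in> nonuniversal_graphs V K ?L"
        using H by (auto simp: nonuniversal_graphs_def)
    qed
    moreover have "inj_on (pivot u v) (?B v)"
      by (rule inj_on_subset[OF inj_on_pivot[of u v V L]]) (auto simp: nonuniversal_graphs_def)
    ultimately have "card (?B v) \<le> card (nonuniversal_graphs V K ?L)"
      using finB[OF L'(1)] by (intro card_inj_on_le)
    then have "real (card (?B v)) \<le> real (card (nonuniversal_graphs V K ?L))" by simp
    also have "\<dots> \<le> real (1 + l) ^ i * ?\<beta>" using Suc.IH[OF L' i] .
    finally show "real (card (?B v)) \<le> real (1 + l) ^ i * ?\<beta>" .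
  qed
  also have "\<dots> \<le> ?\<beta> + real l * (real (1 + l) ^ i * ?\<beta>)"
  proof -
    have "card (L - K) \<le> l" using Suc.prems(2) finL card_mono[of L "L - K"] by auto
    then have "real (card (L - K)) * (real (1 + l) ^ i * ?\<beta>) \<le> real l * (real (1 + l) ^ i * ?\<beta>)"
      by (intro mult_right_mono) auto
    then show ?thesis by simp
  qed
  also have "\<dots> \<le> real (1 + l) ^ i * ?\<beta> + real l * (real (1 + l) ^ i * ?\<beta>)"
  proof (rule add_right_mono)
    have "1 \<le> real (1 + l) ^ i" by (rule one_le_power) simp
    moreover have "0 \<le> ?\<beta>" by simp
    ultimately show "?\<beta> \<le> real (1 + l) ^ i * ?\<beta>" using mult_right_mono[of 1 "real (1 + l) ^ i" ?\<beta>] by simp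
  qed
  also have "\<dots> = real (1 + l) ^ Suc i * ?\<beta>"
    by (simp only: power_Suc mult.assoc of_nat_add of_nat_1 distrib_right mult_1_left)
  finally show ?case .
qed

section \<open>The union bound and its asymptotics\<close>

text \<open>In the assumption \<open>less\<close>, the power of \<open>l + m\<close> bounds the
  choices of \<open>K\<close> and the power of \<open>1 + l\<close> accounts for the pivots. The
  remaining factor bounds the probabilities of the two kinds of failure. A total below 1 leaves a
  graph that is good for all \<open>K\<close> at once.\<close>

lemma exists_vertex_minor_universal:
  assumes "finite V" "card V = l + m" "0 < k" "k \<le> l + m"
    and less: "real ((l + m) * (1 + l)) ^ k * (2 ^ (k choose 2) * (3 / 4) ^ m + 2 ^ k / 2 ^ l) < 1"
  shows "\<exists>G. simple_graph G \<and> vertices G = V \<and> vertex_minor_universal k G"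
proof -
  obtain L where L: "L \<subseteq> V" "card L = l"
    using obtain_subset_with_card_n[of l V] assms(2) by auto
  have finL: "finite L" using L assms(1) finite_subset by metis
  have m: "card (V - L) = m" using L assms(1,2) finL by (simp add: card_Diff_subset)
  let ?\<epsilon> = "2 ^ (k choose 2) * (3 / 4) ^ m + 2 ^ k / 2 ^ l :: real"
  let ?I = "{K. K \<subseteq> V \<and> card K = k}"
  have finI: "finite ?I" using assms(1) by simp
  have "card (\<Union>K\<in>?I. nonuniversal_graphs V K L) \<le> (\<Sum>K\<in>?I. card (nonuniversal_graphs V K L))"
    by (rule card_UN_le[OF finI])
  then have "real (card (\<Union>K\<in>?I. nonuniversal_graphs V K L))
      \<le> real (\<Sum>K\<in>?I. card (nonuniversal_graphs V K L))"
    by (rule of_nat_mono)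
  also have "\<dots> = (\<Sum>K\<in>?I. real (card (nonuniversal_graphs V K L)))" by (rule of_nat_sum)
  also have "\<dots> \<le> (\<Sum>K\<in>?I. real (1 + l) ^ k * (2 ^ (l * m) * ?\<epsilon>))"
  proof (rule sum_mono)
    fix K assume "K \<in> ?I"
    then have K: "K \<subseteq> V" "card K = k" by auto
    have "finite K" using K assms(1) finite_subset by metis
    \<comment> \<open>Replacing \<open>card (K - L)\<close> by \<open>k\<close> makes the bound
      uniform in \<open>K\<close>.\<close>
    then have "card (K - L) \<le> k" using K(2) card_mono[of K "K - L"] by auto
    then have pow: "real (1 + l) ^ card (K - L) \<le> real (1 + l) ^ k" by (intro power_increasing) auto
    have "real (card (nonuniversal_graphs V K L)) \<le> real (1 + l) ^ card (K - L) * (2 ^ (l * m) * ?\<epsilon>)"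
      using card_nonuniversal_le[OF assms(1) K(1) L assms(2) refl] K(2) by simp
    also have "\<dots> \<le> real (1 + l) ^ k * (2 ^ (l * m) * ?\<epsilon>)"
      using pow by (intro mult_right_mono) auto
    finally show "real (card (nonuniversal_graphs V K L)) \<le> real (1 + l) ^ k * (2 ^ (l * m) * ?\<epsilon>)" .
  qed
  also have "\<dots> = real ((l + m) choose k) * (real (1 + l) ^ k * (2 ^ (l * m) * ?\<epsilon>))"
    using n_subsets[OF assms(1), of k] assms(2) by simp
  also have "\<dots> \<le> real ((l + m) ^ k) * (real (1 + l) ^ k * (2 ^ (l * m) * ?\<epsilon>))"
    using binomial_le_pow[OF assms(4)] by (intro mult_right_mono of_nat_mono) auto
  also have "\<dots> = 2 ^ (l * m) * (real ((l + m) * (1 + l)) ^ k * ?\<epsilon>)"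
    by (simp only: of_nat_mult of_nat_power power_mult_distrib mult_ac)
  also have "\<dots> < 2 ^ (l * m) * 1" using less by (intro mult_strict_left_mono) auto
  also have "\<dots> = real (card (bipartite_graphs V L))"
    using card_bipartite_graphs[OF assms(1) L(1)] L(2) m by simp
  finally have lt: "card (\<Union>K\<in>?I. nonuniversal_graphs V K L) < card (bipartite_graphs V L)" by simp
  have "\<not> bipartite_graphs V L \<subseteq> (\<Union>K\<in>?I. nonuniversal_graphs V K L)"
  proof
    assume "bipartite_graphs V L \<subseteq> (\<Union>K\<in>?I. nonuniversal_graphs V K L)"
    moreover have "(\<Union>K\<in>?I. nonuniversal_graphs V K L) \<subseteq> bipartite_graphs V L"
      by (auto simp: nonuniversal_graphs_def)
    ultimately have "bipartite_graphs V L = (\<Union>K\<in>?I. nonuniversal_graphs V K L)" by (rule equalityI)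
    then show False using lt by simp
  qed
  then obtain G where G: "G \<in> bipartite_graphs V L" "\<And>K. K \<in> ?I \<Longrightarrow> G \<notin> nonuniversal_graphs V K L"
    by blast
  then have "simple_graph G" "vertices G = V" by (auto simp: bipartite_graphs_def)
  moreover have "vertex_minor_universal k G"
    using G assms(2-4) \<open>vertices G = V\<close>
    unfolding vertex_minor_universal_def nonuniversal_graphs_def by auto
  ultimately show ?thesis by blast
qed

text \<open>The factor 3 is chosen because 2 * (3/4)^3 = 27/32 is below 1, while 2 * (3/4)^2 is not.
  The failure terms thus decay exponentially in k^2, which beats the factor (2 k^4)^k and the extra
  factor exp(k).\<close>

lemma eventually_failure_probability_less:
  "\<forall>\<^sub>F k in sequentially.
     real ((k\<^sup>2 div 2 + 3 * (k\<^sup>2 div 2)) * (1 + k\<^sup>2 div 2)) ^ k *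
       (2 ^ (k choose 2) * (3 / 4) ^ (3 * (k\<^sup>2 div 2)) + 2 ^ k / 2 ^ (k\<^sup>2 div 2)) < (1::real)"
proof -
  \<comment> \<open>The constant comes from 27/32 = 1 - 5/32 \<le> exp(-5/32) together with
    \<open>j\<close> \<ge> (k^2 - 1)/2, where the -1 covers odd \<open>k\<close>.\<close>
  have "\<forall>\<^sub>F k :: nat in sequentially. (2 * real k ^ 4) powr real k *
      (exp (- (5 / 64) * (real k ^ 2 - 1)) * (1 + exp (real k))) < 1"
    by real_asymp
  with eventually_ge_at_top[of 2] show ?thesis
  proof eventually_elim
    case (elim k)
    define j where "j = k\<^sup>2 div 2"
    have "2 * j \<le> k\<^sup>2" "k\<^sup>2 \<le> 2 * j + 1" by (simp_all add: j_def)
    then have "real (2 * j) \<le> real (k\<^sup>2)" "real (k\<^sup>2) \<le> real (2 * j + 1)"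
      unfolding of_nat_le_iff .
    then have j: "real j \<le> real k ^ 2 / 2" "(real k ^ 2 - 1) / 2 \<le> real j" by simp_all
    have k2: "real k ^ 2 \<ge> 2 ^ 2" using elim(1) by (intro power_mono) auto
    have "real ((j + 3 * j) * (1 + j)) = 4 * real j * (1 + real j)" by (simp add: algebra_simps)
    also have "\<dots> \<le> 4 * (real k ^ 2 / 2) * real k ^ 2"
      using j(1) k2 by (intro mult_mono) auto
    also have "\<dots> = 2 * real k ^ 4" by (simp add: power_eq_if)
    finally have "real ((j + 3 * j) * (1 + j)) ^ k \<le> (2 * real k ^ 4) ^ k"
      by (intro power_mono) auto
    also have "\<dots> = (2 * real k ^ 4) powr real k" using elim(1) by (simp add: powr_realpow)
    finally have A: "real ((j + 3 * j) * (1 + j)) ^ k \<le> (2 * real k ^ 4) powr real k" .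
    have "k choose 2 \<le> j" unfolding j_def choose_two power2_eq_square
      by (intro div_le_mono mult_le_mono) auto
    then have "(2::real) ^ (k choose 2) \<le> 2 ^ j" by (intro power_increasing) auto
    then have "(2::real) ^ (k choose 2) * (3 / 4) ^ (3 * j) \<le> 2 ^ j * (3 / 4) ^ (3 * j)"
      by (intro mult_right_mono) auto
    also have "\<dots> = (2 * (3 / 4) ^ 3) ^ j" by (simp only: power_mult power_mult_distrib)
    also have "\<dots> = (27 / 32) ^ j" by (simp add: power_eq_if)
    finally have B: "(2::real) ^ (k choose 2) * (3 / 4) ^ (3 * j) \<le> (27 / 32) ^ j" .
    have "(2::real) ^ k / 2 ^ j = 2 ^ k * (1 / 2) ^ j" by (simp add: power_divide)
    \<comment> \<open>Weakening 1/2 to 27/32 lets both failure terms share the factor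
      \<open>(27 / 32) ^ j\<close>.\<close>
    also have "\<dots> \<le> exp (real k) * (27 / 32) ^ j"
    proof (intro mult_mono power_mono)
      have "(2::real) \<le> exp 1" using exp_ge_add_one_self[of 1] by simp
      then have "(2::real) ^ k \<le> exp 1 ^ k" by (intro power_mono) auto
      then show "(2::real) ^ k \<le> exp (real k)" by (simp flip: exp_of_nat_mult)
    qed auto
    finally have "(2::real) ^ (k choose 2) * (3 / 4) ^ (3 * j) + 2 ^ k / 2 ^ j
        \<le> (27 / 32) ^ j * (1 + exp (real k))" using B by (simp add: algebra_simps)
    also have "(27 / 32 :: real) ^ j \<le> exp (- (5 / 32)) ^ j"
      using exp_ge_add_one_self[of "- (5 / 32)"] by (intro power_mono) auto
    also have "\<dots> = exp (- (5 / 32) * real j)" by (simp flip: exp_of_nat_mult add: mult_ac)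
    also have "\<dots> \<le> exp (- (5 / 64) * (real k ^ 2 - 1))" using j(2) by simp
    finally have C: "(2::real) ^ (k choose 2) * (3 / 4) ^ (3 * j) + 2 ^ k / 2 ^ j
        \<le> exp (- (5 / 64) * (real k ^ 2 - 1)) * (1 + exp (real k))"
      by (simp add: mult_right_mono)
    have "real ((j + 3 * j) * (1 + j)) ^ k * (2 ^ (k choose 2) * (3 / 4) ^ (3 * j) + 2 ^ k / 2 ^ j)
        \<le> (2 * real k ^ 4) powr real k *
      (exp (- (5 / 64) * (real k ^ 2 - 1)) * (1 + exp (real k)))"
      by (intro mult_mono A C) auto
    then show ?case unfolding j_def[symmetric] using elim(2) by linarith
  qed
qed

theorem theorem8:
  fixes \<alpha> :: real
  assumes "\<alpha> > 2"
  shows "\<exists>k0 :: nat. \<forall>k :: nat. k > k0 \<longrightarrow>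
           (\<exists>G :: nat sgraph. simple_graph G \<and> vertex_minor_universal k G \<and>
              real (card (vertices G)) \<le> \<alpha> * (real k)\<^sup>2)"
proof -
  have "\<forall>\<^sub>F k in sequentially. \<exists>G :: nat sgraph. simple_graph G \<and> vertex_minor_universal k G \<and>
      real (card (vertices G)) \<le> \<alpha> * (real k)\<^sup>2"
    using eventually_failure_probability_less eventually_gt_at_top[of 1]
  proof eventually_elim
    case (elim k)
    define j where "j = k\<^sup>2 div 2"
    have j: "2 * j \<le> k\<^sup>2" "k\<^sup>2 \<le> 2 * j + 1" by (simp_all add: j_def)
    have "2 * k \<le> k\<^sup>2" using elim(2) by (simp add: power2_eq_square)
    \<comment> \<open>From 2k \<le> k^2 \<le> 2j + 1 even \<open>k\<close> \<le> \<open>j\<close>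
      follows by integrality.\<close>
    then have k: "k \<le> j + 3 * j" using j(2) elim(2) by linarith
    have "\<exists>G :: nat sgraph. simple_graph G \<and> vertices G = {..<j + 3 * j} \<and> vertex_minor_universal k G"
      using elim k by (intro exists_vertex_minor_universal[where l = j and m = "3 * j"])
        (simp_all add: j_def)
    then obtain G :: "nat sgraph" where G: "simple_graph G" "vertices G = {..<j + 3 * j}"
      "vertex_minor_universal k G" by blast
    \<comment> \<open>The order is 4j with 2j \<le> k^2, which is where the constant 2
      arises.\<close>
    have "real (card (vertices G)) \<le> real (2 * k\<^sup>2)"
      unfolding G(2) using j(1) by (intro of_nat_mono) simp
    also have "\<dots> \<le> \<alpha> * (real k)\<^sup>2" using assms by (simp add: mult_right_mono)
    finally show ?case using G by blast
  qed
  then show ?thesis by (auto simp: eventually_at_top_dense)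
qed

end
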